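(* Let $\nu$ be a Borel probability measure on $\mathbb{T}^1$ and let $f : \mathbb{T}^1 \to \mathbb{T}^1$ be a $\nu$-preserving, orientation-preserving homeomorphism with irrational rotation number. Then the dynamical system $(\mathbb{T}^1, \nu, \mathbb{N}, f)$ does not have the shrinking target property (STP).
   Context: $\mathbb{T}^1 = \mathbb{R}/\mathbb{Z}$ with its usual quotient metric; $B(x,\rho)$ is the open ball ($B(x,0)=\emptyset$). $\mathbb{N}$ is the usual additive semigroup, acting by the iterates $f^n$. A system $(M,\nu,\mathbb{N},f)$, with $M$ a metric space, $\nu$ a finite Borel measure on $M$ and $f : M \to M$ a $\nu$-preserving map, has STP if for every $x \in M$ and every radius sequence $r : \mathbb{N} \to \mathbb{R}_{\geq 0}$ (no monotonicity required), with $r_n := r(n)$, such that $\sum_{n \in \mathbb{N}} \nu(B(x, r_n)) = \infty$, one has $\nu(\limsup_n f^{-n}B(x, r_n)) = \nu(M)$, where $f^{-n}B(x,r_n)$ is the preimage under $f^n$ and $\limsup_n f^{-n}B(x,r_n)$ is the set of points lying in $f^{-n}B(x,r_n)$ for infinitely many $n$. *)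

theory Defs
  imports "HOL-Probability.Probability"
begin

section \<open>The circle \<open>\<real>/\<int>\<close>\<close>

quotient_type circle = real / "\<lambda>x y. x - y \<in> \<int>"
  morphisms rep_circle to_circle
proof (rule equivpI)
  show "reflp (\<lambda>x y::real. x - y \<in> \<int>)"
    by (simp add: reflp_def)
  show "symp (\<lambda>x y::real. x - y \<in> \<int>)"
    by (metis (mono_tags, lifting) Ints_minus minus_diff_eq sympI)
  show "transp (\<lambda>x y::real. x - y \<in> \<int>)"
  proof (rule transpI)
    fix x y z :: real
    assume "x - y \<in> \<int>" "y - z \<in> \<int>"
    then have "(x - y) + (y - z) \<in> \<int>" by (rule Ints_add)
    then show "x - z \<in> \<int>" by simp
  qed
qed

lemma to_circle_eq_iff: "to_circle x = to_circle y \<longleftrightarrow> x - y \<in> \<int>"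
  using circle.abs_eq_iff by simp

lemma INF_abs_diff_int: "(INF k::int. \<bar>z - of_int k\<bar>) = \<bar>z - of_int (round z)\<bar>" for z :: real
  by (rule cInf_eq_minimum) (auto intro: round_diff_minimal)

instantiation circle :: metric_space
begin

lift_definition dist_circle :: "circle \<Rightarrow> circle \<Rightarrow> real"
  is "\<lambda>x y. INF k::int. \<bar>x - y - of_int k\<bar>"
proof -
  fix x x' y y' :: real
  assume "x - x' \<in> \<int>" "y - y' \<in> \<int>"
  then obtain a b :: int where ab: "x - x' = of_int a" "y - y' = of_int b"
    by (auto elim!: Ints_cases)
  have "range (\<lambda>k::int. \<bar>x - y - of_int k\<bar>) = range (\<lambda>k::int. \<bar>x' - y' - of_int k\<bar>)"
  proof (intro equalityI subsetI; elim rangeE)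
    fix t :: real and k :: int
    assume "t = \<bar>x - y - of_int k\<bar>"
    then have "t = \<bar>x' - y' - of_int (k - a + b)\<bar>" using ab by simp
    then show "t \<in> range (\<lambda>k::int. \<bar>x' - y' - of_int k\<bar>)" by blast
  next
    fix t :: real and k :: int
    assume "t = \<bar>x' - y' - of_int k\<bar>"
    then have "t = \<bar>x - y - of_int (k + a - b)\<bar>" using ab by simp
    then show "t \<in> range (\<lambda>k::int. \<bar>x - y - of_int k\<bar>)" by blast
  qed
  then show "(INF k::int. \<bar>x - y - of_int k\<bar>) = (INF k::int. \<bar>x' - y' - of_int k\<bar>)"
    by simp
qed

definition uniformity_circle :: "(circle \<times> circle) filter"
  where "uniformity_circle = (INF e\<in>{0<..}. principal {(x, y). dist x y < e})"

definition open_circle :: "circle set \<Rightarrow> bool"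
  where "open_circle U \<longleftrightarrow> (\<forall>x\<in>U. \<forall>\<^sub>F (x', y) in uniformity. x' = x \<longrightarrow> y \<in> U)"

instance
proof
  show "(uniformity :: (circle \<times> circle) filter) =
      (INF e\<in>{0<..}. principal {(x, y). dist x y < e})"
    by (rule uniformity_circle_def)
  show "open U \<longleftrightarrow> (\<forall>x\<in>U. \<forall>\<^sub>F (x', y) in uniformity. x' = x \<longrightarrow> y \<in> U)"
    for U :: "circle set"
    by (rule open_circle_def)
  show "dist x y = 0 \<longleftrightarrow> x = y" for x y :: circle
  proof (transfer, unfold INF_abs_diff_int)
    fix x y :: real
    show "\<bar>x - y - of_int (round (x - y))\<bar> = 0 \<longleftrightarrow> x - y \<in> \<int>"
      by (metis Ints_cases Ints_of_int abs_eq_0 diff_self eq_iff_diff_eq_0 round_of_int)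
  qed
  show "dist x y \<le> dist x z + dist y z" for x y z :: circle
  proof (transfer, unfold INF_abs_diff_int)
    fix x y z :: real
    let ?k = "round (x - z)" and ?l = "round (y - z)"
    have "\<bar>x - y - of_int (round (x - y))\<bar> \<le> \<bar>x - y - of_int (?k - ?l)\<bar>"
      by (rule round_diff_minimal)
    also have "\<dots> \<le> \<bar>x - z - of_int ?k\<bar> + \<bar>y - z - of_int ?l\<bar>"
      by simp
    finally show "\<bar>x - y - of_int (round (x - y))\<bar>
        \<le> \<bar>x - z - of_int ?k\<bar> + \<bar>y - z - of_int ?l\<bar>" .
  qed
qed

end

section \<open>Orientation and rotation number of circle homeomorphisms\<close>

definition circle_lift :: "(real \<Rightarrow> real) \<Rightarrow> (circle \<Rightarrow> circle) \<Rightarrow> bool" where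
  "circle_lift F f \<longleftrightarrow> continuous_on UNIV F \<and> (\<forall>x. to_circle (F x) = f (to_circle x))"

definition orientation_preserving_homeo :: "(circle \<Rightarrow> circle) \<Rightarrow> bool" where
  "orientation_preserving_homeo f \<longleftrightarrow>
     (\<exists>g. homeomorphism UNIV UNIV f g) \<and> (\<exists>F. circle_lift F f \<and> strict_mono F)"

definition translation_number :: "(real \<Rightarrow> real) \<Rightarrow> real" where
  "translation_number F = (THE t. \<forall>x. (\<lambda>n. ((F ^^ n) x - x) / real n) \<longlonglongrightarrow> t)"

text \<open>Two continuous lifts differ by an integer constant, so for an orientation-preserving
  homeomorphism the class modulo \<open>\<int>\<close> does not depend on the lift that is chosen, and every
  lift is strictly increasing.\<close>

definition rotation_number :: "(circle \<Rightarrow> circle) \<Rightarrow> circle" where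
  "rotation_number f = to_circle (translation_number (SOME F. circle_lift F f))"

definition irrational_class :: "circle \<Rightarrow> bool" where
  "irrational_class \<rho> \<longleftrightarrow> \<rho> \<notin> to_circle ` \<rat>"

section \<open>The shrinking target property\<close>

definition measure_preserving_map :: "'a measure \<Rightarrow> ('a \<Rightarrow> 'a) \<Rightarrow> bool" where
  "measure_preserving_map \<nu> f \<longleftrightarrow> f \<in> measurable \<nu> \<nu> \<and> distr \<nu> \<nu> f = \<nu>"

text \<open>Meant for a finite Borel measure \<open>\<nu>\<close> and a \<open>\<nu>\<close>-preserving map \<open>f\<close>.
  The sum is taken in the extended nonnegative reals.\<close>

definition STP :: "'a::metric_space measure \<Rightarrow> ('a \<Rightarrow> 'a) \<Rightarrow> bool" where
  "STP \<nu> f \<longleftrightarrow>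
     (\<forall>x. \<forall>r :: nat \<Rightarrow> real. (\<forall>n. 0 \<le> r n) \<longrightarrow>
        (\<Sum>n. emeasure \<nu> (ball x (r n))) = \<infinity> \<longrightarrow>
        emeasure \<nu> {y. \<exists>\<^sub>\<infinity>n. y \<in> (f ^^ n) -` ball x (r n)} = emeasure \<nu> (space \<nu>))"

end

theory Submission
  imports Defs
begin

text \<open>
  The measure \<open>\<nu>\<close> has no atoms, because an atom would be a periodic point and would force a rational
  rotation number. Fix \<open>x\<close> in the support of \<open>\<nu>\<close> and a small \<open>r > 0\<close>. The preimages of
  \<open>ball x r\<close> under the iterates of \<open>f\<close> are arcs, all of the same small positive measure. By compactness
  the end points converge along a subsequence, so infinitely many of these arcs lie in a single
  set of measure less than \<open>1\<close>: one of the arcs enlarged by small balls around the two limit points.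
  Taking the radius \<open>r\<close> along this subsequence and \<open>0\<close> elsewhere violates STP.
\<close>

section \<open>The circle\<close>

lemma to_circle_surj: "\<exists>s. to_circle s = z"
  by (metis Quotient_circle Quotient_abs_rep)

lemma to_circle_add_int [simp]: "to_circle (s + of_int k) = to_circle s"
  by (simp add: to_circle_eq_iff)

lemma dist_to_circle:
  "dist (to_circle x) (to_circle y) = \<bar>x - y - of_int (round (x - y))\<bar>"
  by (simp add: dist_circle.abs_eq INF_abs_diff_int)

lemma dist_to_circle_le: "dist (to_circle x) (to_circle y) \<le> \<bar>x - y\<bar>"
  unfolding dist_to_circle using round_diff_minimal[of "x - y" 0] by simp

lemma continuous_on_to_circle: "continuous_on S to_circle"
  unfolding continuous_on_iff
  by (metis dist_real_def dist_to_circle_le order_le_less_trans)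

text \<open>The infimum defining the distance is attained at the nearest integer, so the distance is
  below \<open>r\<close> exactly when some integer translate achieves this.\<close>

lemma in_ball_to_circle_iff:
  "to_circle s \<in> ball (to_circle c) r \<longleftrightarrow> (\<exists>k::int. \<bar>s - c - of_int k\<bar> < r)"
proof -
  have "\<bar>s - c - of_int (round (s - c))\<bar> \<le> \<bar>s - c - of_int k\<bar>" for k
    by (rule round_diff_minimal)
  then show ?thesis
    by (subst mem_ball, subst dist_commute) (metis dist_to_circle order_le_less_trans)
qed

lemma compact_UNIV_circle: "compact (UNIV :: circle set)"
proof -
  have "z \<in> to_circle ` {0..1}" for z
  proof -
    obtain s where s: "to_circle s = z" using to_circle_surj by blast
    have "to_circle (frac s) = z"
      using s to_circle_add_int[of s "- \<lfloor>s\<rfloor>"] by (simp add: frac_def)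
    moreover have "frac s \<in> {0..1}"
      using frac_ge_0[of s] frac_lt_1[of s] by simp
    ultimately show ?thesis by blast
  qed
  then have "UNIV = to_circle ` {0..1}" by blast
  then show ?thesis
    by (metis compact_Icc compact_continuous_image continuous_on_to_circle)
qed

section \<open>Lifts of circle homeomorphisms\<close>

text \<open>Distinct integers are at least 1 apart, so continuity on the connected line rules out
  any jump.\<close>

lemma continuous_Ints_constant:
  fixes F :: "real \<Rightarrow> real"
  assumes "continuous_on UNIV F" and "\<And>x. F x \<in> \<int>"
  obtains k :: int where "\<And>x. F x = of_int k"
proof -
  have "F constant_on UNIV"
  proof (rule continuous_discrete_range_constant[OF connected_UNIV assms(1)])
    fix x :: real
    have "1 \<le> norm (F y - F x)" if "F y \<noteq> F x" for y
      using that assms(2)[of x] assms(2)[of y]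
      by (metis Ints_diff Ints_nonzero_abs_ge1 real_norm_def right_minus_eq)
    then show "\<exists>e>0. \<forall>y. y \<in> UNIV \<and> F y \<noteq> F x \<longrightarrow> e \<le> norm (F y - F x)"
      by (intro exI[of _ 1]) auto
  qed
  then show ?thesis
    using that assms(2) by (metis Ints_cases UNIV_I constant_on_def)
qed

text \<open>The difference of two lifts is continuous and integer-valued. This allows monotonicity
  to be carried from one lift to every other.\<close>

lemma circle_lift_unique:
  assumes "circle_lift F f" and "circle_lift G f"
  obtains k :: int where "\<And>x. F x = G x + of_int k"
proof -
  have "F x - G x \<in> \<int>" for x
    using assms by (simp add: circle_lift_def flip: to_circle_eq_iff)
  moreover have "continuous_on UNIV (\<lambda>x. F x - G x)"
    using assms by (auto simp: circle_lift_def intro: continuous_on_diff)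
  ultimately obtain k :: int where "\<And>x. F x - G x = of_int k"
    using continuous_Ints_constant[of "\<lambda>x. F x - G x"] by blast
  then show ?thesis using that by (metis add.commute diff_add_cancel)
qed

text \<open>The increment of \<open>F\<close> over a unit interval is an integer, positive by
  monotonicity. If it were at least 2, the value \<open>F x + 1\<close> would be taken strictly
  inside the interval, and \<open>f\<close> would identify two distinct points.\<close>

lemma circle_lift_add_1:
  assumes "inj f" and lift: "circle_lift F f" and mono: "strict_mono F"
  shows "F (x + 1) = F x + 1"
proof -
  have cont: "continuous_on UNIV F" and eq: "\<And>x. to_circle (F x) = f (to_circle x)"
    using lift by (auto simp: circle_lift_def)
  have "to_circle (x + 1) = to_circle x" for x
    using to_circle_add_int[of x 1] by simp
  then have "F (x + 1) - F x \<in> \<int>"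
    by (metis eq to_circle_eq_iff)
  then obtain d :: int where d: "F (x + 1) - F x = of_int d"
    by (rule Ints_cases)
  have "d \<ge> 1"
  proof -
    have "F x < F (x + 1)" using mono by (simp add: strict_mono_less)
    then have "real_of_int d > 0" using d by simp
    then show ?thesis by simp
  qed
  moreover have "\<not> d \<ge> 2"
  proof
    assume "d \<ge> 2"
    then have "F x + 1 < F (x + 1)" using d by linarith
    moreover have "continuous_on {x..x+1} F" using cont continuous_on_subset by blast
    ultimately obtain y where y: "x \<le> y" "y \<le> x + 1" "F y = F x + 1"
      using IVT'[of F x "F x + 1" "x + 1"] by auto
    then have "f (to_circle y) = f (to_circle x)"
      by (metis eq to_circle_add_int of_int_1)
    then have "y - x \<in> \<int>"
      using \<open>inj f\<close> by (simp add: inj_eq to_circle_eq_iff)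
    moreover have "y \<noteq> x" "y \<noteq> x + 1" using y \<open>F x + 1 < F (x + 1)\<close> by auto
    then have "y - x \<noteq> 0" "\<bar>y - x\<bar> < 1" using y by auto
    ultimately show False using Ints_nonzero_abs_less1 by blast
  qed
  ultimately show ?thesis using d by (simp add: algebra_simps)
qed

text \<open>Stated for an arbitrary lift because \<open>rotation_number\<close> selects its lift by
  \<open>SOME\<close>, with no promise that it is the increasing one.\<close>

lemma orientation_preserving_homeo_lift:
  assumes "orientation_preserving_homeo f" and lift: "circle_lift F f"
  shows "strict_mono F" and "F (x + 1) = F x + 1"
proof -
  from assms(1) obtain g G where g: "homeomorphism UNIV UNIV f g"
    and G: "circle_lift G f" "strict_mono G"
    by (auto simp: orientation_preserving_homeo_def)
  from circle_lift_unique[OF lift G(1)] obtain k :: int where k: "\<And>x. F x = G x + of_int k"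
    by blast
  then show mono: "strict_mono F"
    using G(2) by (auto simp: strict_mono_def)
  have "inj f" using g by (metis homeomorphism_def injI UNIV_I)
  then show "F (x + 1) = F x + 1"
    using lift mono by (rule circle_lift_add_1)
qed

lemma commute_add_int:
  fixes F :: "real \<Rightarrow> real"
  assumes "\<And>x. F (x + 1) = F x + 1"
  shows "F (x + of_int k) = F x + of_int k"
proof (induction k rule: int_induct[of _ 0])
  case (step1 i)
  then show ?case using assms[of "x + of_int i"] by (simp add: add.assoc)
next
  case (step2 i)
  then show ?case using assms[of "x + of_int (i - 1)"] by simp
qed simp

lemma funpow_commute_add_int:
  fixes F :: "real \<Rightarrow> real"
  assumes "\<And>x. F (x + 1) = F x + 1"
  shows "(F ^^ n) (x + of_int k) = (F ^^ n) x + of_int k"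
  by (induction n) (simp_all add: commute_add_int[of F, OF assms])

lemma to_circle_funpow_lift:
  assumes "circle_lift F f"
  shows "to_circle ((F ^^ n) x) = (f ^^ n) (to_circle x)"
  using assms by (induction n) (auto simp: circle_lift_def)

section \<open>Periodic points and the rotation number\<close>

text \<open>The orbit of \<open>y\<close> stays at bounded distance from uniform motion of speed
  \<open>k / q\<close>, and every other orbit stays at bounded distance from that of
  \<open>y\<close>. Dividing by \<open>n\<close> removes both errors.\<close>

lemma translation_number_periodic:
  fixes F :: "real \<Rightarrow> real"
  assumes mono: "strict_mono F" and deg: "\<And>x. F (x + 1) = F x + 1"
    and q: "q > 0" and per: "(F ^^ q) y = y + of_int k"
  shows "translation_number F = of_int k / real q"
proof -
  let ?t = "of_int k / real q"
  \<comment> \<open>The deviation from uniform motion repeats with period \<open>q\<close>, so it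
    takes finitely many values.\<close>
  define \<psi> where "\<psi> n = (F ^^ n) y - real n * ?t" for n
  have psi_q: "\<psi> (n + q) = \<psi> n" for n
    using q by (simp add: \<psi>_def funpow_add per funpow_commute_add_int[of F, OF deg] field_simps)
  have "\<psi> (n + m * q) = \<psi> n" for n m
  proof (induction m)
    case (Suc m)
    then show ?case using psi_q[of "n + m * q"] by (simp add: algebra_simps)
  qed simp
  then have psi_mod: "\<psi> n = \<psi> (n mod q)" for n
    by (metis mod_div_mult_eq)
  define C where "C = Max ((\<lambda>n. \<bar>\<psi> n\<bar>) ` {..<q})"
  have psi_le: "\<bar>\<psi> n\<bar> \<le> C" for n
    unfolding C_def psi_mod[of n] using q by (intro Max_ge) auto
  have lim: "(\<lambda>n. ((F ^^ n) x - x) / real n) \<longlonglongrightarrow> ?t" for x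
  proof -
    \<comment> \<open>The point \<open>x\<close> lies between two integer translates of
      \<open>y\<close>. Iterates of \<open>F\<close> are monotone and commute with these
      translations, so the bracket persists for all \<open>n\<close>.\<close>
    define m where "m = \<lceil>\<bar>x - y\<bar>\<rceil>"
    have m: "y + of_int (- m) \<le> x" "x \<le> y + of_int m"
      unfolding m_def of_int_minus using le_of_int_ceiling[of "\<bar>x - y\<bar>"] by linarith+
    have monon: "mono (F ^^ n)" for n
      using mono by (simp add: mono_pow strict_mono_mono)
    have near: "\<bar>(F ^^ n) x - (F ^^ n) y\<bar> \<le> of_int m" for n
      using monoD[OF monon[of n] m(1)] monoD[OF monon[of n] m(2)]
      unfolding funpow_commute_add_int[of F, OF deg] by linarith
    have bound: "norm (((F ^^ n) x - x) / real n - ?t) \<le> (C + of_int m + \<bar>x\<bar>) / real n"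
      if "n > 0" for n
    proof -
      have "\<bar>(F ^^ n) x - x - real n * ?t\<bar> \<le> C + of_int m + \<bar>x\<bar>"
        using near[of n] psi_le[of n] unfolding \<psi>_def by linarith
      moreover have "((F ^^ n) x - x) / real n - ?t = ((F ^^ n) x - x - real n * ?t) / real n"
        using that by (simp add: field_simps)
      ultimately show ?thesis
        using that by (simp only: real_norm_def abs_divide) (simp add: divide_right_mono)
    qed
    have "(\<lambda>n. (C + of_int m + \<bar>x\<bar>) / real n) \<longlonglongrightarrow> 0"
      by (rule lim_const_over_n)
    moreover have "\<forall>\<^sub>F n in sequentially.
        norm (((F ^^ n) x - x) / real n - ?t) \<le> (C + of_int m + \<bar>x\<bar>) / real n"
      using eventually_gt_at_top[of 0] by (rule eventually_mono) (rule bound)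
    ultimately have "(\<lambda>n. ((F ^^ n) x - x) / real n - ?t) \<longlonglongrightarrow> 0"
      by (rule Lim_null_comparison[rotated])
    then show ?thesis by (rule LIM_zero_cancel)
  qed
  \<comment> \<open>The description by \<open>THE\<close> also needs uniqueness, which is that of
    limits.\<close>
  show ?thesis
    unfolding translation_number_def
    by (rule the_equality) (use lim LIMSEQ_unique in blast)+
qed

text \<open>A point of period \<open>q\<close> lifts to some \<open>y\<close> that
  \<open>F ^^ q\<close> moves by an integer \<open>k\<close>, which forces the rational translation
  number \<open>k / q\<close>.\<close>

lemma irrational_class_no_periodic_point:
  assumes f: "orientation_preserving_homeo f" and irr: "irrational_class (rotation_number f)"
    and "q > 0"
  shows "(f ^^ q) p \<noteq> p"
proof
  assume per: "(f ^^ q) p = p"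
  \<comment> \<open>This must be the very lift used by \<open>rotation_number\<close>.\<close>
  define F where "F = (SOME F. circle_lift F f)"
  have lift: "circle_lift F f"
    unfolding F_def using f by (metis orientation_preserving_homeo_def someI_ex)
  obtain y where y: "to_circle y = p" using to_circle_surj by blast
  have "to_circle ((F ^^ q) y) = to_circle y"
    using to_circle_funpow_lift[OF lift] per y by simp
  then have "(F ^^ q) y - y \<in> \<int>" by (simp add: to_circle_eq_iff)
  then obtain k :: int where "(F ^^ q) y - y = of_int k" by (rule Ints_cases)
  then have "(F ^^ q) y = y + of_int k" by simp
  then have "translation_number F = of_int k / real q"
    using translation_number_periodic orientation_preserving_homeo_lift[OF f lift] \<open>q > 0\<close>
    by blast
  then have "rotation_number f \<in> to_circle ` \<rat>"
    by (simp add: rotation_number_def F_def)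
  then show False using irr by (simp add: irrational_class_def)
qed

section \<open>Preimages of balls under the iterates\<close>

lemma surj_lift:
  fixes F :: "real \<Rightarrow> real"
  assumes cont: "continuous_on UNIV F" and deg: "\<And>x. F (x + 1) = F x + 1"
  shows "surj F"
proof -
  have "\<exists>x. F x = v" for v
  proof -
    define k where "k = \<lfloor>v - F 0\<rfloor>"
    have "F (of_int k) = F 0 + of_int k" "F (of_int k + 1) = F 0 + of_int k + 1"
      using commute_add_int[of F 0 k, OF deg] deg[of "of_int k"] by auto
    then have "F (of_int k) \<le> v" "v \<le> F (of_int k + 1)"
      unfolding k_def by linarith+
    then show ?thesis
      using IVT'[of F "of_int k" v "of_int k + 1"] cont continuous_on_subset by fastforce
  qed
  then show ?thesis by (metis surj_def)
qed

text \<open>On the line, the increasing bijection \<open>F ^^ n\<close> pulls an interval back to an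
  interval. The bounds on \<open>a\<close> and \<open>b\<close> do not depend on \<open>n\<close>,
  which later permits extracting convergent end points.\<close>

lemma preimage_ball_arc:
  assumes lift: "circle_lift F f" and mono: "strict_mono F" and deg: "\<And>x. F (x + 1) = F x + 1"
    and r: "0 < r" "r < 1/2"
  obtains a b where "a \<in> {0..1}" "b \<in> {0..2}"
    "(f ^^ n) -` ball x r = to_circle ` {a<..<b}"
proof -
  let ?G = "F ^^ n"
  have G: "?G (s + of_int k) = ?G s + of_int k" for s k
    using funpow_commute_add_int[of F] deg by blast
  have monoG: "strict_mono ?G"
    by (induction n) (use mono in \<open>auto simp: strict_mono_def\<close>)
  have "surj F"
    using lift deg by (intro surj_lift) (simp_all add: circle_lift_def)
  then have "surj ?G" by (rule surj_fn)
  obtain c where c: "to_circle c = x" using to_circle_surj by blast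
  obtain a0 b0 where a0: "?G a0 = c - r" and b0: "?G b0 = c + r"
    using \<open>surj ?G\<close> by (metis surjD)
  \<comment> \<open>Both end points are shifted by the same integer, bringing \<open>a\<close> into
    the unit interval without changing the arc.\<close>
  define a where "a = a0 + of_int (- \<lfloor>a0\<rfloor>)"
  define b where "b = b0 + of_int (- \<lfloor>a0\<rfloor>)"
  have a: "?G a = c - r + of_int (- \<lfloor>a0\<rfloor>)" and b: "?G b = c + r + of_int (- \<lfloor>a0\<rfloor>)"
    unfolding a_def b_def G a0 b0 by simp_all
  have "a < b"
  proof -
    have "?G a < ?G b" using r(1) unfolding a b by simp
    then show ?thesis using monoG by (simp add: strict_mono_less)
  qed
  \<comment> \<open>The ball has width \<open>2 * r < 1\<close>, while \<open>F ^^ n\<close> maps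
    \<open>a\<close> and \<open>a + 1\<close> to points at distance exactly 1. Hence
    \<open>b < 2\<close>.\<close>
  moreover have "b < a + 1"
  proof -
    have "?G b < ?G (a + of_int 1)" using r(2) unfolding G a b by simp
    then show ?thesis using monoG by (simp add: strict_mono_less)
  qed
  moreover have a01: "0 \<le> a" "a < 1" unfolding a_def by linarith+
  moreover have "(f ^^ n) -` ball x r = to_circle ` {a<..<b}"
  proof (rule set_eqI)
    fix z
    obtain s where s: "to_circle s = z" using to_circle_surj by blast
    have "z \<in> (f ^^ n) -` ball x r \<longleftrightarrow> to_circle (?G s) \<in> ball (to_circle c) r"
      using to_circle_funpow_lift[OF lift] s c by simp
    also have "\<dots> \<longleftrightarrow> (\<exists>k::int. \<bar>?G s - c - of_int k\<bar> < r)"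
      by (rule in_ball_to_circle_iff)
    also have "\<dots> \<longleftrightarrow> (\<exists>k::int. s + of_int k \<in> {a<..<b})"
    proof -
      have eq: "s + of_int k \<in> {a<..<b} \<longleftrightarrow> \<bar>?G s - c - of_int (- \<lfloor>a0\<rfloor> - k)\<bar> < r" for k
      proof -
        have "s + of_int k \<in> {a<..<b} \<longleftrightarrow> ?G a < ?G (s + of_int k) \<and> ?G (s + of_int k) < ?G b"
          using monoG by (simp add: strict_mono_less)
        then show ?thesis unfolding G a b by auto
      qed
      \<comment> \<open>The change of index is an involution of the integers, so both existential
        statements range over the same cases.\<close>
      have "- \<lfloor>a0\<rfloor> - (- \<lfloor>a0\<rfloor> - k) = k" for k by simp
      then show ?thesis unfolding eq by metis
    qed
    also have "\<dots> \<longleftrightarrow> z \<in> to_circle ` {a<..<b}"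
    proof
      assume "\<exists>k::int. s + of_int k \<in> {a<..<b}"
      then show "z \<in> to_circle ` {a<..<b}" using s by (metis imageI to_circle_add_int)
    next
      assume "z \<in> to_circle ` {a<..<b}"
      then obtain u where u: "u \<in> {a<..<b}" "to_circle u = to_circle s" using s by auto
      then obtain k :: int where "u - s = of_int k"
        by (auto simp: to_circle_eq_iff elim: Ints_cases)
      then have "u = s + of_int k" by simp
      then show "\<exists>k::int. s + of_int k \<in> {a<..<b}" using u by blast
    qed
    finally show "z \<in> (f ^^ n) -` ball x r \<longleftrightarrow> z \<in> to_circle ` {a<..<b}" .
  qed
  ultimately show ?thesis using that[of a b] by auto
qed

section \<open>Measures on the circle\<close>

text \<open>Continuity from above, applied to balls of radius \<open>1 / (n + 1)\<close> shrinking
  to the null set \<open>{x}\<close>.\<close>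

lemma emeasure_ball_small:
  fixes x :: "'a::metric_space" and M :: "'a measure"
  assumes "finite_measure M" and sets: "sets M = sets borel" and null: "emeasure M {x} = 0"
    and "e > 0"
  obtains d where "d > 0" "emeasure M (ball x d) < e"
proof -
  interpret finite_measure M by fact
  let ?B = "\<lambda>n. ball x (inverse (real (Suc n)))"
  have "(\<lambda>n. emeasure M (?B n)) \<longlonglongrightarrow> emeasure M (\<Inter>n. ?B n)"
  proof (rule Lim_emeasure_decseq)
    show "range ?B \<subseteq> sets M" unfolding sets by (simp add: image_subset_iff)
    show "decseq ?B"
      by (intro decseq_SucI subset_ball) (simp add: field_simps)
    show "emeasure M (?B n) \<noteq> \<infinity>" for n by simp
  qed
  moreover have "(\<Inter>n. ?B n) = {x}"
  proof (intro equalityI subsetI)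
    fix y assume y: "y \<in> (\<Inter>n. ?B n)"
    have "dist x y = 0"
    proof (rule ccontr)
      assume "dist x y \<noteq> 0"
      then obtain n where "inverse (real (Suc n)) < dist x y"
        using reals_Archimedean by (metis zero_less_dist_iff dist_self)
      moreover have "y \<in> ?B n" using y by blast
      ultimately show False by (simp only: mem_ball)
    qed
    then show "y \<in> {x}" by simp
  qed simp
  ultimately have "(\<lambda>n. emeasure M (?B n)) \<longlonglongrightarrow> 0" using null by simp
  then have "\<forall>\<^sub>F n in sequentially. emeasure M (?B n) < e"
    using \<open>e > 0\<close> by (rule order_tendstoD(2))
  then obtain n where "emeasure M (?B n) < e"
    unfolding eventually_sequentially by blast
  then show ?thesis by (intro that[of "inverse (real (Suc n))"]) simp_all
qed

text \<open>Otherwise every point has a null ball around it, and by compactness finitely many of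
  these cover the space.\<close>

lemma support_nonempty:
  fixes M :: "'a::metric_space measure"
  assumes comp: "compact (UNIV :: 'a set)" and sets: "sets M = sets borel"
    and "emeasure M UNIV \<noteq> 0"
  obtains x where "\<And>r. r > 0 \<Longrightarrow> emeasure M (ball x r) > 0"
proof (rule ccontr)
  assume "\<not> thesis"
  with that have "\<forall>x. \<exists>r>0. emeasure M (ball x r) = 0"
    by (metis gr_zeroI)
  then obtain r where r: "\<And>x. r x > 0" "\<And>x. emeasure M (ball x (r x)) = 0" by metis
  have "UNIV \<subseteq> (\<Union>x. ball x (r x))" using r(1) centre_in_ball by blast
  then obtain C where C: "finite C" "UNIV \<subseteq> (\<Union>x\<in>C. ball x (r x))"
    by (rule compactE_image[OF comp, rotated]) auto
  have "(\<Union>x\<in>C. ball x (r x)) \<in> null_sets M"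
    using C(1) r(2) sets by (intro null_sets_UN') (auto simp: null_sets_def countable_finite)
  moreover have "(\<Union>x\<in>C. ball x (r x)) = UNIV" using C(2) by blast
  ultimately show False using assms(3) by auto
qed

section \<open>Iterates of measure-preserving maps and absence of atoms\<close>

lemma measure_preserving_map_funpow:
  assumes "measure_preserving_map M f"
  shows "measure_preserving_map M (f ^^ n)"
proof (induction n)
  case 0
  have "distr M M id = M" unfolding id_def by (rule distr_id)
  then show ?case
    unfolding measure_preserving_map_def funpow.simps using measurable_ident by blast
next
  case (Suc n)
  then have "f \<in> measurable M M" "f ^^ n \<in> measurable M M"
    "distr M M f = M" "distr M M (f ^^ n) = M"
    using assms by (auto simp: measure_preserving_map_def)
  then show ?case
    using distr_distr[of f M M "f ^^ n" M]
    unfolding measure_preserving_map_def funpow.simps by (metis measurable_comp)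
qed

lemma measure_preserving_map_emeasure_vimage:
  assumes "measure_preserving_map M f" and "space M = UNIV" and "A \<in> sets M"
  shows "emeasure M (f -` A) = emeasure M A"
proof -
  have f: "f \<in> measurable M M" and distr: "distr M M f = M"
    using assms(1) by (auto simp: measure_preserving_map_def)
  have "emeasure M A = emeasure (distr M M f) A" by (simp only: distr)
  also have "\<dots> = emeasure M (f -` A)"
    using emeasure_distr[OF f assms(3)] by (simp only: assms(2) Int_UNIV_right)
  finally show ?thesis ..
qed

text \<open>Any \<open>k\<close> of the infinitely many large terms already contribute at least
  \<open>k * c\<close>. Used both to exclude atoms and to obtain the divergence in STP.\<close>

lemma suminf_ennreal_eq_top:
  fixes u :: "nat \<Rightarrow> ennreal"
  assumes "infinite {n. c \<le> u n}" and "c > 0"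
  shows "(\<Sum>n. u n) = \<infinity>"
proof -
  have "of_nat k * c \<le> (\<Sum>n. u n)" for k
  proof -
    obtain S where S: "finite S" "card S = k" "S \<subseteq> {n. c \<le> u n}"
      using infinite_arbitrarily_large[OF assms(1)] by blast
    have "of_nat k * c = (\<Sum>n\<in>S. c)" using S by simp
    also have "\<dots> \<le> sum u S" using S by (intro sum_mono) auto
    also have "\<dots> \<le> (\<Sum>n. u n)" using S by (intro sum_le_suminf) auto
    finally show ?thesis .
  qed
  then have "(SUP k. of_nat k * c) \<le> (\<Sum>n. u n)" by (intro SUP_least)
  moreover have "(SUP k::nat. of_nat k * c) = \<top>"
    using \<open>c > 0\<close> by (simp add: ennreal_SUP_of_nat_eq_top ennreal_top_mult flip: SUP_mult_right_ennreal)
  ultimately show ?thesis by (simp add: top_unique)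
qed

text \<open>The orbit of \<open>p\<close> consists of infinitely many distinct points of equal mass,
  so positive mass would contradict finiteness.\<close>

lemma atomless_if_no_periodic_point:
  fixes M :: "'a::t1_space measure"
  assumes "finite_measure M" and sets: "sets M = sets borel"
    and mp: "measure_preserving_map M f" and "inj f"
    and aper: "\<And>q p. q > 0 \<Longrightarrow> (f ^^ q) p \<noteq> p"
  shows "emeasure M {p} = 0"
proof -
  interpret finite_measure M by fact
  have space: "space M = UNIV" using sets_eq_imp_space_eq[OF sets] by simp
  have orbit: "emeasure M {(f ^^ n) p} = emeasure M {p}" for n
  proof -
    have "inj (f ^^ n)" using \<open>inj f\<close> by (rule inj_fn)
    have "{(f ^^ n) p} \<in> sets M" unfolding sets by simp
    moreover have "(f ^^ n) -` {(f ^^ n) p} = {p}"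
      using \<open>inj (f ^^ n)\<close> by (auto dest: injD)
    ultimately show ?thesis
      using measure_preserving_map_emeasure_vimage[OF measure_preserving_map_funpow[OF mp] space]
      by metis
  qed
  \<comment> \<open>Cancelling the injective \<open>f ^^ m\<close> turns a coincidence at times
    \<open>m < n\<close> into a period \<open>n - m\<close>.\<close>
  have "inj (\<lambda>n. (f ^^ n) p)"
  proof (rule linorder_injI)
    fix m n :: nat assume "m < n"
    then have "(f ^^ n) p = (f ^^ m) ((f ^^ (n - m)) p)"
      by (metis add_diff_inverse_nat comp_apply funpow_add not_less_iff_gr_or_eq)
    moreover have "(f ^^ (n - m)) p \<noteq> p" using aper \<open>m < n\<close> by simp
    ultimately show "(f ^^ m) p \<noteq> (f ^^ n) p"
      using inj_fn[OF \<open>inj f\<close>, of m] by (metis injD)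
  qed
  then have "disjoint_family (\<lambda>n. {(f ^^ n) p})"
    by (auto simp: disjoint_family_on_def dest: injD)
  then have "(\<Sum>n. emeasure M {(f ^^ n) p}) = emeasure M (\<Union>n. {(f ^^ n) p})"
    by (intro suminf_emeasure) (auto simp: sets)
  then have "(\<Sum>n::nat. emeasure M {p}) \<noteq> \<infinity>"
    by (simp add: orbit)
  then show ?thesis
    using suminf_ennreal_eq_top[of "emeasure M {p}" "\<lambda>_. emeasure M {p}"]
    by (auto simp: zero_less_iff_neq_zero)
qed

section \<open>Failure of the shrinking target property\<close>

theorem corollary1p6:
  fixes \<nu> :: "circle measure" and f :: "circle \<Rightarrow> circle"
  assumes "prob_space \<nu>"
    and "sets \<nu> = sets borel"
    and "measure_preserving_map \<nu> f"
    and "orientation_preserving_homeo f"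
    and "irrational_class (rotation_number f)"
  shows "\<not> STP \<nu> f"
proof
  assume STP: "STP \<nu> f"
  interpret prob_space \<nu> by fact
  note sets = assms(2)
  have space: "space \<nu> = UNIV" using sets_eq_imp_space_eq[OF sets] by simp
  have open_sets: "open U \<Longrightarrow> U \<in> sets \<nu>" for U unfolding sets by simp
  obtain F where lift: "circle_lift F f"
    using assms(4) by (auto simp: orientation_preserving_homeo_def)
  note lift' = orientation_preserving_homeo_lift[OF assms(4) lift]
  have "inj f"
    using assms(4) unfolding orientation_preserving_homeo_def by (metis homeomorphism_def injI UNIV_I)
  then have null: "emeasure \<nu> {p} = 0" for p
    using atomless_if_no_periodic_point[OF finite_measure_axioms sets assms(3)]
      irrational_class_no_periodic_point[OF assms(4,5)] by blast
  \<comment> \<open>The bound 1/4 serves three sets, one arc and two balls, whose union then has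
    measure at most 3/4.\<close>
  note small = emeasure_ball_small[OF finite_measure_axioms sets null, of "ennreal (1/4)"]
  have "emeasure \<nu> UNIV \<noteq> 0" using emeasure_space_1 space by simp
  then obtain x where supp: "\<And>r. r > 0 \<Longrightarrow> emeasure \<nu> (ball x r) > 0"
    using support_nonempty[OF compact_UNIV_circle sets] by blast
  obtain d where d: "d > 0" "emeasure \<nu> (ball x d) < ennreal (1/4)"
    using small by auto
  \<comment> \<open>The cap 1/4 ensures \<open>r < 1/2\<close>, as the description of preimages as
    arcs requires.\<close>
  define r where "r = min d (1/4)"
  have r: "0 < r" "r < 1/2" using d by (auto simp: r_def)
  have "emeasure \<nu> (ball x r) \<le> emeasure \<nu> (ball x d)"
    by (intro emeasure_mono subset_ball open_sets) (auto simp: r_def)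
  with d have r_small: "emeasure \<nu> (ball x r) \<le> ennreal (1/4)" by simp
  define arc where "arc n = (f ^^ n) -` ball x r" for n
  have "\<exists>a b. a \<in> {0..1} \<and> b \<in> {0..2} \<and> arc n = to_circle ` {a<..<b}" for n
    unfolding arc_def using preimage_ball_arc[OF lift lift' r, of n x] by metis
  then obtain a b where ab: "\<And>n. a n \<in> {0..1}" "\<And>n. b n \<in> {0..2}"
    and arc: "\<And>n. arc n = to_circle ` {a n<..<b n}"
    by metis
  have "seq_compact ({0..1::real} \<times> {0..2::real})"
    by (intro compact_imp_seq_compact compact_Times compact_Icc)
  moreover have "\<forall>n. (a n, b n) \<in> {0..1} \<times> {0..2}" using ab by blast
  ultimately obtain l and \<sigma> :: "nat \<Rightarrow> nat" where \<sigma>: "strict_mono \<sigma>"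
    and lim: "((\<lambda>n. (a n, b n)) \<circ> \<sigma>) \<longlonglongrightarrow> l"
    by (rule seq_compactE) blast
  obtain \<alpha> \<beta> where l: "l = (\<alpha>, \<beta>)" by fastforce
  have lim_a: "(\<lambda>n. a (\<sigma> n)) \<longlonglongrightarrow> \<alpha>" and lim_b: "(\<lambda>n. b (\<sigma> n)) \<longlonglongrightarrow> \<beta>"
    using tendsto_fst[OF lim] tendsto_snd[OF lim] by (simp_all add: l o_def)
  obtain u where u: "u > 0" "emeasure \<nu> (ball (to_circle \<alpha>) u) < ennreal (1/4)"
    using small by auto
  obtain v where v: "v > 0" "emeasure \<nu> (ball (to_circle \<beta>) v) < ennreal (1/4)"
    using small by auto
  have "\<forall>\<^sub>F n in sequentially. dist (a (\<sigma> n)) \<alpha> < u \<and> dist (b (\<sigma> n)) \<beta> < v"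
    using tendstoD[OF lim_a u(1)] tendstoD[OF lim_b v(1)] by (rule eventually_conj)
  then obtain n0 where n0: "\<And>n. n \<ge> n0 \<Longrightarrow> \<bar>a (\<sigma> n) - \<alpha>\<bar> < u \<and> \<bar>b (\<sigma> n) - \<beta>\<bar> < v"
    by (auto simp: eventually_sequentially dist_real_def)
  define A where "A = arc (\<sigma> n0) \<union> (ball (to_circle \<alpha>) u \<union> ball (to_circle \<beta>) v)"
  have arc_sub: "arc (\<sigma> n) \<subseteq> A" if "n \<ge> n0" for n
  proof
    note near = n0[OF that] n0[OF order_refl]
    fix z assume "z \<in> arc (\<sigma> n)"
    then obtain s where s: "a (\<sigma> n) < s" "s < b (\<sigma> n)" "z = to_circle s"
      by (auto simp: arc)
    \<comment> \<open>If \<open>s\<close> is outside the interval of index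
      \<open>\<sigma> n0\<close>, it lies between the left end points of the two intervals or
      between the right ones. Both left ones are within \<open>u\<close> of \<alpha>, both right
      ones within \<open>v\<close> of \<beta>.\<close>
    consider "a (\<sigma> n0) < s" "s < b (\<sigma> n0)" | "\<bar>\<alpha> - s\<bar> < u" | "\<bar>\<beta> - s\<bar> < v"
      using near s by linarith
    then show "z \<in> A"
    proof cases
      case 1
      then show ?thesis using s by (auto simp: A_def arc)
    next
      case 2
      then show ?thesis using s dist_to_circle_le[of \<alpha> s] by (auto simp: A_def)
    next
      case 3
      then show ?thesis using s dist_to_circle_le[of \<beta> s] by (auto simp: A_def)
    qed
  qed
  have arc_sets: "arc n \<in> sets \<nu>" for n
    using measurable_sets[of "f ^^ n" \<nu> \<nu> "ball x r"] measure_preserving_map_funpow[OF assms(3), of n]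
    by (simp add: arc_def measure_preserving_map_def space open_sets)
  have arc_small: "emeasure \<nu> (arc n) \<le> ennreal (1/4)" for n
    using measure_preserving_map_emeasure_vimage[OF measure_preserving_map_funpow[OF assms(3)] space]
      r_small by (simp add: arc_def open_sets)
  let ?B = "ball (to_circle \<alpha>) u" and ?C = "ball (to_circle \<beta>) v"
  have ball_sets: "?B \<in> sets \<nu>" "?C \<in> sets \<nu>" by (simp_all add: open_sets)
  then have A_sets: "A \<in> sets \<nu>"
    unfolding A_def using arc_sets by blast
  have "emeasure \<nu> A \<le> emeasure \<nu> (arc (\<sigma> n0)) + emeasure \<nu> (?B \<union> ?C)"
    unfolding A_def using arc_sets ball_sets by (intro emeasure_subadditive) blast+
  also have "\<dots> \<le> emeasure \<nu> (arc (\<sigma> n0)) + (emeasure \<nu> ?B + emeasure \<nu> ?C)"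
    using ball_sets by (intro add_left_mono emeasure_subadditive)
  also have "\<dots> \<le> ennreal (1/4) + (ennreal (1/4) + ennreal (1/4))"
    by (intro add_mono arc_small less_imp_le[OF u(2)] less_imp_le[OF v(2)])
  also have "\<dots> < 1"
  proof -
    have "ennreal (1/4) + (ennreal (1/4) + ennreal (1/4)) = ennreal (1/4) + ennreal (1/4 + 1/4)"
      by (rule arg_cong[where f = "(+) (ennreal (1/4))", OF ennreal_plus[symmetric]]) auto
    also have "\<dots> = ennreal (1/4 + (1/4 + 1/4))"
      by (rule ennreal_plus[symmetric]) auto
    also have "\<dots> < ennreal 1" by (rule ennreal_lessI) auto
    finally show ?thesis by (simp only: ennreal_1)
  qed
  finally have A_less: "emeasure \<nu> A < 1" .
  define N where "N = \<sigma> ` {n0..}"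
  \<comment> \<open>Radius 0 gives the empty ball, so times outside \<open>N\<close> produce no
    hits.\<close>
  define R where "R n = (if n \<in> N then r else 0)" for n
  have "infinite N"
    unfolding N_def using strict_mono_imp_inj_on[OF \<sigma>] infinite_Ici[of n0]
    by (meson finite_imageD inj_on_subset subset_UNIV)
  moreover have "N \<subseteq> {n. emeasure \<nu> (ball x r) \<le> emeasure \<nu> (ball x (R n))}"
    by (auto simp: R_def)
  ultimately have "infinite {n. emeasure \<nu> (ball x r) \<le> emeasure \<nu> (ball x (R n))}"
    by (meson infinite_super)
  then have "(\<Sum>n. emeasure \<nu> (ball x (R n))) = \<infinity>"
    using supp[OF r(1)] by (rule suminf_ennreal_eq_top)
  moreover have "\<forall>n. 0 \<le> R n" using r by (simp add: R_def)
  ultimately have "emeasure \<nu> {y. \<exists>\<^sub>\<infinity>n. y \<in> (f ^^ n) -` ball x (R n)} = emeasure \<nu> (space \<nu>)"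
    using STP unfolding STP_def by blast
  then have full: "emeasure \<nu> {y. \<exists>\<^sub>\<infinity>n. y \<in> (f ^^ n) -` ball x (R n)} = 1"
    by (simp only: emeasure_space_1)
  \<comment> \<open>A single hit suffices: it must occur at a time in \<open>N\<close>, and every
    arc with such an index lies in \<open>A\<close>.\<close>
  have "{y. \<exists>\<^sub>\<infinity>n. y \<in> (f ^^ n) -` ball x (R n)} \<subseteq> A"
  proof (rule subsetI, unfold mem_Collect_eq)
    fix y assume "\<exists>\<^sub>\<infinity>n. y \<in> (f ^^ n) -` ball x (R n)"
    then obtain n where n: "y \<in> (f ^^ n) -` ball x (R n)" using INFM_EX by blast
    have "n \<in> N"
    proof (rule ccontr)
      assume "n \<notin> N"
      then have "ball x (R n) = {}" by (simp add: R_def)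
      with n show False by simp
    qed
    with n have "y \<in> arc n" by (simp add: arc_def R_def)
    with \<open>n \<in> N\<close> show "y \<in> A" using arc_sub unfolding N_def by blast
  qed
  from emeasure_mono[OF this A_sets] have "1 \<le> emeasure \<nu> A" by (simp only: full)
  with A_less show False by (metis leD)
qed

end
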